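(* For every integer $k\ge1$, as $n\to\infty$, \[\operatorname{fdim}_2(Q_n^{1,k})\to \left(1-\tfrac{1}{k+1}\right)^{-k}(k+1),\] and this limit is at most $e(k+1)$.
   Context: For $1\le \ell\le k\le n$, $Q_n^{\ell,k}$ denotes the suborder of the Boolean lattice of subsets of $[n]$ (ordered by inclusion) consisting of all subsets of cardinality $\ell$ and all subsets of cardinality $k$. A function $f$ from a poset $P$ to the $2$-element chain $\mathbf{2}$ is monotone if $x\le y$ implies $f(x)\le f(y)$. A fractional $2$-realiser of a finite poset $P$ is a function $w$ assigning a nonnegative weight to each monotone function $f:P\to\mathbf{2}$ such that for every pair $x,y\in P$ with $x\not\ge y$, $\sum\{w(f): f(x)<f(y)\}\ge1$. The fractional $2$-dimension $\operatorname{fdim}_2(P)$ is the minimum over all fractional $2$-realisers $w$ of the total weight $\sum_f w(f)$. *)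

theory Defs
  imports "HOL-Analysis.Analysis"
begin

text \<open>
  A poset is a set \<open>P\<close> of elements of an \<open>order\<close> type with the inherited order; the 2-element
  chain is \<open>bool\<close> with \<open>False < True\<close>. Functions on \<open>P\<close> are taken extensional, so that
  each monotone function \<open>P \<rightarrow> 2\<close> is counted exactly once.
\<close>

definition monotone_to_two :: "'a::order set \<Rightarrow> ('a \<Rightarrow> bool) set" where
  "monotone_to_two P = {f \<in> extensional P. mono_on P f}"

definition fractional_2_realiser :: "'a::order set \<Rightarrow> (('a \<Rightarrow> bool) \<Rightarrow> real) \<Rightarrow> bool" where
  "fractional_2_realiser P w \<longleftrightarrow>
     (\<forall>f \<in> monotone_to_two P. 0 \<le> w f) \<and>
     (\<forall>x\<in>P. \<forall>y\<in>P. \<not> x \<ge> y \<longrightarrow> (\<Sum>f | f \<in> monotone_to_two P \<and> f x < f y. w f) \<ge> 1)"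

definition total_weight :: "'a::order set \<Rightarrow> (('a \<Rightarrow> bool) \<Rightarrow> real) \<Rightarrow> real" where
  "total_weight P w = (\<Sum>f \<in> monotone_to_two P. w f)"

text \<open>For finite \<open>P\<close> this infimum is a minimum, see \<open>fdim2_minimum\<close> below.\<close>

definition fdim2 :: "'a::order set \<Rightarrow> real" where
  "fdim2 P = Inf {total_weight P w | w. fractional_2_realiser P w}"

definition Q_levels :: "nat \<Rightarrow> nat \<Rightarrow> nat \<Rightarrow> nat set set" where
  "Q_levels n l k = {A. A \<subseteq> {1..n} \<and> (card A = l \<or> card A = k)}"

lemma finite_Q_levels: "finite (Q_levels n l k)"
  by (rule finite_subset[of _ "Pow {1..n}"]) (auto simp: Q_levels_def)

lemma finite_monotone_to_two:
  assumes "finite P"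
  shows "finite (monotone_to_two P)"
proof -
  have "monotone_to_two P \<subseteq> P \<rightarrow>\<^sub>E UNIV"
    unfolding monotone_to_two_def PiE_def by blast
  moreover have "finite (P \<rightarrow>\<^sub>E (UNIV :: bool set))"
    using assms by (intro finite_PiE) simp_all
  ultimately show ?thesis by (rule finite_subset)
qed

lemma fractional_2_realiser_exists:
  fixes P :: "'a::order set"
  assumes "finite P"
  shows "fractional_2_realiser P (\<lambda>_. 1)"
proof -
  have "1 \<le> (\<Sum>f | f \<in> monotone_to_two P \<and> f x < f y. 1::real)"
    if "x \<in> P" "y \<in> P" "\<not> y \<le> x" for x y
  proof -
    let ?S = "{f. f \<in> monotone_to_two P \<and> f x < f y}"
    have "restrict (\<lambda>z. y \<le> z) P \<in> ?S"
      using that by (auto simp: monotone_to_two_def mono_on_def)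
    moreover have "finite ?S"
      using finite_monotone_to_two[OF assms] by simp
    ultimately have "card ?S \<noteq> 0" by auto
    then show ?thesis by simp
  qed
  then show ?thesis by (simp add: fractional_2_realiser_def)
qed

lemma fdim2_minimum:
  fixes P :: "'a::order set"
  assumes fin: "finite P"
  shows "\<exists>w. fractional_2_realiser P w \<and> total_weight P w = fdim2 P"
    and "fractional_2_realiser P w \<Longrightarrow> fdim2 P \<le> total_weight P w"
proof -
  define F where "F = monotone_to_two P"
  have finF: "finite F" unfolding F_def by (rule finite_monotone_to_two[OF fin])
  define C where "C = total_weight P (\<lambda>_. 1)"
  have C0: "0 \<le> C" by (simp add: C_def total_weight_def)
  define B where "B f = (if f \<in> F then {0..C} else {0})" for f
  have compB: "compact (PiE UNIV B)"
  proof -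
    have "compactin (product_topology (\<lambda>_. euclidean) UNIV) (PiE UNIV B)"
      unfolding compactin_PiE by (auto simp: B_def)
    then show ?thesis by (simp add: euclidean_product_topology)
  qed
  define R where "R = {w. fractional_2_realiser P w}"
  have closed_nonneg: "closed {w :: ('a \<Rightarrow> bool) \<Rightarrow> real. 0 \<le> w f}" for f
    by (rule closed_Collect_le) auto
  have closed_sum: "closed {w :: ('a \<Rightarrow> bool) \<Rightarrow> real. 1 \<le> (\<Sum>f\<in>G. w f)}" for G
    by (rule closed_Collect_le)
       (rule continuous_on_const, rule continuous_on_sum, rule continuous_on_product_coordinates)
  have "R = (\<Inter>f\<in>F. {w. 0 \<le> w f}) \<inter> (\<Inter>x\<in>P. \<Inter>y\<in>{y\<in>P. \<not> x \<ge> y}.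
      {w. 1 \<le> (\<Sum>f | f \<in> monotone_to_two P \<and> f x < f y. w f)})"
    unfolding R_def fractional_2_realiser_def F_def by blast
  then have "closed R"
    by (simp only:) (intro closed_Int closed_INT ballI closed_nonneg closed_sum)
  then have comp: "compact (PiE UNIV B \<inter> R)"
    using compB by (rule compact_Int_closed[rotated])
  define trunc :: "(('a \<Rightarrow> bool) \<Rightarrow> real) \<Rightarrow> ('a \<Rightarrow> bool) \<Rightarrow> real"
    where "trunc w f = (if f \<in> F then w f else 0)" for w f
  have trunc: "trunc w \<in> PiE UNIV B \<inter> R" "total_weight P (trunc w) = total_weight P w"
    if "w \<in> R" "total_weight P w \<le> C" for w
  proof -
    show "total_weight P (trunc w) = total_weight P w"
      by (auto simp: total_weight_def trunc_def F_def intro: sum.cong)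
    have "(\<Sum>f | f \<in> monotone_to_two P \<and> f x < f y. trunc w f)
        = (\<Sum>f | f \<in> monotone_to_two P \<and> f x < f y. w f)" for x y
      by (rule sum.cong) (auto simp: trunc_def F_def)
    then have "trunc w \<in> R"
      using that(1) by (auto simp: R_def fractional_2_realiser_def trunc_def F_def)
    moreover have nonneg: "0 \<le> w f" if "f \<in> F" for f
      using that \<open>w \<in> R\<close> by (auto simp: R_def fractional_2_realiser_def F_def)
    have "w f \<le> C" if "f \<in> F" for f
      using member_le_sum[of f F w] that nonneg finF \<open>total_weight P w \<le> C\<close>
      by (auto simp: total_weight_def F_def[symmetric])
    then have "trunc w \<in> PiE UNIV B"
      using nonneg by (auto simp: B_def trunc_def)
    ultimately show "trunc w \<in> PiE UNIV B \<inter> R" by blast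
  qed
  have one: "(\<lambda>_. 1) \<in> R"
    using fractional_2_realiser_exists[OF fin] by (simp add: R_def)
  have ne: "PiE UNIV B \<inter> R \<noteq> {}"
    using trunc(1)[OF one] by (auto simp: C_def)
  have cont: "continuous_on (PiE UNIV B \<inter> R) (total_weight P)"
    unfolding total_weight_def
    by (intro continuous_on_sum continuous_on_subset[OF continuous_on_product_coordinates]) auto
  obtain v where v: "v \<in> PiE UNIV B \<inter> R"
    and vmin: "\<And>u. u \<in> PiE UNIV B \<inter> R \<Longrightarrow> total_weight P v \<le> total_weight P u"
    using continuous_attains_inf[OF comp ne cont] by metis
  have min: "total_weight P v \<le> total_weight P u" if "u \<in> R" for u
  proof (cases "total_weight P u \<le> C")
    case True
    then show ?thesis using vmin[OF trunc(1)[OF that]] trunc(2)[OF that] by simp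
  next
    case False
    have "total_weight P v \<le> C"
      using vmin[OF trunc(1)[OF one]] trunc(2)[OF one] by (simp add: C_def)
    then show ?thesis using False by simp
  qed
  have eq: "fdim2 P = total_weight P v"
    unfolding fdim2_def using v min by (intro cInf_eq_minimum) (auto simp: R_def)
  show "\<exists>w. fractional_2_realiser P w \<and> total_weight P w = fdim2 P"
    using v eq by (auto simp: R_def)
  show "fractional_2_realiser P w \<Longrightarrow> fdim2 P \<le> total_weight P w"
    using min eq by (simp add: R_def)
qed

end

theory Submission
  imports Defs
begin

text \<open>
  Let \<open>M = p (1 - p)\<^sup>k\<close> with \<open>p = 1 / (k + 1)\<close>, which is the maximum of \<open>t (1 - t)\<^sup>k\<close> over
  \<open>0 \<le> t \<le> 1\<close>; the claimed limit is \<open>1 / M\<close>.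

  Upper bound, for every \<open>n\<close>: choose \<open>S \<subseteq> [n]\<close> at random, each point independently with
  probability \<open>p\<close>, and take the monotone function \<open>A \<mapsto> (A \<inter> S \<noteq> {})\<close>. If \<open>i \<in> y - x\<close>, then
  \<open>x\<close> and \<open>y\<close> are separated as soon as \<open>x \<inter> S = {}\<close> and \<open>i \<in> S\<close>, which has probability
  \<open>p (1 - p)\<^bsup>|x|\<^esup> \<ge> M\<close>. So the distribution scaled by \<open>1 / M\<close> is a fractional 2-realiser.

  Lower bound: count the pairs \<open>(A, {i})\<close> with \<open>|A| = k\<close> and \<open>i \<notin> A\<close>. A monotone function
  with exactly \<open>s\<close> singletons mapped to 1 separates at most \<open>s (n - s choose k)\<close> of them,
  hence at most \<open>n\<^bsup>k+1\<^esup> M / k!\<close>, whereas there are \<open>(n - k) (n choose k) \<sim> n\<^bsup>k+1\<^esup> / k!\<close> in total.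
\<close>

lemma mult_power_one_minus_le_max:
  fixes t :: real
  assumes "t \<le> 1" "k \<ge> 1"
  shows "t * (1 - t) ^ k \<le> 1 / (real k + 1) * (1 - 1 / (real k + 1)) ^ k"
proof -
  \<comment> \<open>The left side is 1 at \<open>j = 0\<close> and drops by
    \<open>(j + 1) * u ^ j * (u - 1)^2\<close> from \<open>j\<close> to
    \<open>j + 1\<close>.\<close>
  have key: "(real j + 1) * u ^ j - real j * u ^ Suc j \<le> 1" if "u \<ge> 0" for u :: real and j
  proof (induction j)
    case (Suc j)
    have "(real (Suc j) + 1) * u ^ Suc j - real (Suc j) * u ^ Suc (Suc j)
        = (real j + 1) * u ^ j - real j * u ^ Suc j - (real j + 1) * u ^ j * (u - 1)\<^sup>2"
      by (simp add: algebra_simps power2_eq_square)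
    also have "\<dots> \<le> (real j + 1) * u ^ j - real j * u ^ Suc j"
      using that by simp
    finally show ?case using Suc.IH by linarith
  qed simp
  define q where "q = 1 - 1 / (real k + 1)"
  have q: "q > 0" "q = real k / (real k + 1)"
    using assms(2) by (auto simp: q_def field_simps)
  define u where "u = (1 - t) / q"
  have u: "u \<ge> 0" "1 - t = u * q"
    using assms(1) q(1) by (auto simp: u_def)
  have "t = 1 - u * q" using u(2) by simp
  also have "\<dots> = ((real k + 1) - real k * u) / (real k + 1)"
    unfolding q(2) by (simp add: field_simps)
  finally have t: "t = ((real k + 1) - real k * u) / (real k + 1)" .
  have "t * (1 - t) ^ k = ((real k + 1) * u ^ k - real k * u ^ Suc k) * (1 / (real k + 1) * q ^ k)"
    unfolding u(2) power_mult_distrib by (subst t) (simp add: field_simps)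
  also have "\<dots> \<le> 1 * (1 / (real k + 1) * q ^ k)"
    using key[OF u(1), of k] q(1) by (intro mult_right_mono) auto
  finally show ?thesis by (simp add: q_def)
qed

text \<open>Under the product measure this is the probability that \<open>S\<close> misses
  \<open>x\<close> and contains \<open>i\<close>: points of \<open>x\<close> contribute
  \<open>1 - p\<close>, the point \<open>i\<close> contributes \<open>p\<close>, all others sum to
  1. As a polynomial identity it holds in any commutative ring.\<close>

lemma sum_Pow_disjoint_mem_weight:
  fixes p :: "'b::comm_ring_1"
  assumes "finite N" "x \<subseteq> N" "i \<in> N" "i \<notin> x"
  shows "(\<Sum>S | S \<in> Pow N \<and> x \<inter> S = {} \<and> i \<in> S. p ^ card S * (1 - p) ^ card (N - S))
    = p * (1 - p) ^ card x"
proof -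
  \<comment> \<open>\<open>f\<close> and \<open>g\<close> are the factors for \<open>j\<close>
    inside and outside \<open>S\<close>. The zeros kill exactly the forbidden \<open>S\<close>, so
    the restricted sum becomes a full sum over \<open>Pow N\<close>, which factors as the product of
    \<open>f j + g j\<close>.\<close>
  define f g where "f j = (if j \<in> x then 0 else p)" and "g j = (if j = i then 0 else 1 - p)" for j
  have summand: "prod f S * prod g (N - S)
      = (if x \<inter> S = {} \<and> i \<in> S then p ^ card S * (1 - p) ^ card (N - S) else 0)"
    if "S \<in> Pow N" for S
  proof -
    have fin: "finite S" using that assms(1) by (auto intro: finite_subset)
    show ?thesis
    proof (cases "x \<inter> S = {} \<and> i \<in> S")
      case True
      then have "prod f S = (\<Prod>j\<in>S. p)" "prod g (N - S) = (\<Prod>j\<in>N - S. 1 - p)"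
        unfolding f_def g_def by (intro prod.cong refl; auto)+
      with True show ?thesis by simp
    next
      case False
      then consider j where "j \<in> x" "j \<in> S" | "i \<in> N - S" using assms(3) by blast
      then have "prod f S = 0 \<or> prod g (N - S) = 0"
      proof cases
        case 1
        then have "\<exists>j\<in>S. f j = 0" by (auto simp: f_def)
        then show ?thesis using fin prod_zero by blast
      next
        case 2
        then have "\<exists>j\<in>N - S. g j = 0" by (auto simp: g_def)
        then show ?thesis using assms(1) prod_zero by blast
      qed
      with False show ?thesis by auto
    qed
  qed
  have fg: "f j + g j = (if j \<in> x then 1 - p else 1) * (if j = i then p else 1)" for j
    using assms(4) by (auto simp: f_def g_def)
  have "(\<Sum>S | S \<in> Pow N \<and> x \<inter> S = {} \<and> i \<in> S. p ^ card S * (1 - p) ^ card (N - S))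
      = (\<Sum>S\<in>Pow N. if x \<inter> S = {} \<and> i \<in> S then p ^ card S * (1 - p) ^ card (N - S) else 0)"
    using assms(1) by (intro sum.inter_filter) simp
  also have "\<dots> = (\<Sum>S\<in>Pow N. prod f S * prod g (N - S))"
    by (intro sum.cong refl summand[symmetric])
  also have "\<dots> = (\<Prod>j\<in>N. f j + g j)"
    using assms(1) by (simp add: prod_add)
  also have "\<dots> = (\<Prod>j\<in>N. if j \<in> x then 1 - p else 1) * p"
    unfolding fg prod.distrib using assms(1,3) by simp
  also have "(\<Prod>j\<in>N. if j \<in> x then 1 - p else 1) = (1 - p) ^ card x"
    using assms(1,2) by (simp add: prod.If_cases Int_absorb1)
  finally show ?thesis by (simp add: mult.commute)
qed

lemma sum_Pow_weight:
  fixes p :: "'b::comm_ring_1"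
  assumes "finite N"
  shows "(\<Sum>S\<in>Pow N. p ^ card S * (1 - p) ^ card (N - S)) = 1"
  using prod_add[OF assms, of "\<lambda>_. p" "\<lambda>_. 1 - p"] by simp

text \<open>Weights on an index set are pushed forward along \<open>F\<close>. This allows weighting
  the random sets \<open>S\<close> themselves, although distinct \<open>S\<close> may induce the
  same function on \<open>P\<close>.\<close>

lemma fdim2_le_weighted_family:
  fixes P :: "'a::order set" and F :: "'i \<Rightarrow> 'a \<Rightarrow> bool"
  assumes "finite P" "finite I"
    and F: "\<And>s. s \<in> I \<Longrightarrow> F s \<in> monotone_to_two P"
    and v: "\<And>s. s \<in> I \<Longrightarrow> 0 \<le> v s"
    and sep: "\<And>x y. x \<in> P \<Longrightarrow> y \<in> P \<Longrightarrow> \<not> x \<ge> y \<Longrightarrow> (\<Sum>s | s \<in> I \<and> F s x < F s y. v s) \<ge> 1"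
  shows "fdim2 P \<le> sum v I"
proof -
  define w where "w f = (\<Sum>s | s \<in> I \<and> F s = f. v s)" for f
  note fin = finite_monotone_to_two[OF assms(1)]
  have push: "(\<Sum>f\<in>G. w f) = (\<Sum>s | s \<in> I \<and> F s \<in> G. v s)" if "finite G" for G
  proof -
    have "(\<Sum>s | s \<in> I \<and> F s \<in> G. v s)
        = (\<Sum>f\<in>G. \<Sum>s | s \<in> {s. s \<in> I \<and> F s \<in> G} \<and> F s = f. v s)"
      using assms(2) that by (intro sum.group[symmetric]) auto
    also have "\<dots> = (\<Sum>f\<in>G. w f)"
      unfolding w_def by (intro sum.cong refl) auto
    finally show ?thesis by simp
  qed
  have "fractional_2_realiser P w"
    unfolding fractional_2_realiser_def
  proof (intro conjI ballI impI)
    show "0 \<le> w f" for f unfolding w_def using v by (intro sum_nonneg) auto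
  next
    fix x y assume xy: "x \<in> P" "y \<in> P" "\<not> x \<ge> y"
    have "(\<Sum>f | f \<in> monotone_to_two P \<and> f x < f y. w f)
        = (\<Sum>s | s \<in> I \<and> F s \<in> {f. f \<in> monotone_to_two P \<and> f x < f y}. v s)"
      using fin by (intro push) simp
    also have "{s. s \<in> I \<and> F s \<in> {f. f \<in> monotone_to_two P \<and> f x < f y}}
        = {s. s \<in> I \<and> F s x < F s y}"
      using F by auto
    finally show "(\<Sum>f | f \<in> monotone_to_two P \<and> f x < f y. w f) \<ge> 1"
      using sep[OF xy] by simp
  qed
  then have "fdim2 P \<le> total_weight P w"
    by (rule fdim2_minimum(2)[OF assms(1)])
  also have "\<dots> = (\<Sum>s | s \<in> I \<and> F s \<in> monotone_to_two P. v s)"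
    unfolding total_weight_def by (rule push[OF fin])
  also have "{s. s \<in> I \<and> F s \<in> monotone_to_two P} = I" using F by auto
  finally show ?thesis .
qed

text \<open>Weak linear programming duality by double counting: in an optimal realiser every pair of
  \<open>R\<close> receives weight at least 1, while each function serves at most \<open>m\<close>
  pairs.\<close>

lemma card_pairs_le_fdim2:
  fixes P :: "'a::order set"
  assumes "finite P" "finite R"
    and R: "\<And>x y. (x, y) \<in> R \<Longrightarrow> x \<in> P \<and> y \<in> P \<and> \<not> x \<ge> y"
    and m: "\<And>f. f \<in> monotone_to_two P \<Longrightarrow> real (card {(x, y) \<in> R. f x < f y}) \<le> m"
  shows "real (card R) \<le> m * fdim2 P"
proof -
  obtain w where w: "fractional_2_realiser P w" "total_weight P w = fdim2 P"
    using fdim2_minimum(1)[OF assms(1)] by blast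
  note fin = finite_monotone_to_two[OF assms(1)]
  have "real (card R) = (\<Sum>z\<in>R. 1)" by simp
  also have "\<dots> \<le> (\<Sum>z\<in>R. \<Sum>f | f \<in> monotone_to_two P \<and> f (fst z) < f (snd z). w f)"
    using w(1) R unfolding fractional_2_realiser_def by (intro sum_mono) fastforce
  also have "\<dots> = (\<Sum>f\<in>monotone_to_two P. \<Sum>z | z \<in> R \<and> f (fst z) < f (snd z). w f)"
    using assms(2) fin by (rule sum.swap_restrict)
  also have "\<dots> = (\<Sum>f\<in>monotone_to_two P. real (card {(x, y) \<in> R. f x < f y}) * w f)"
    by (simp add: case_prod_unfold)
  also have "\<dots> \<le> (\<Sum>f\<in>monotone_to_two P. m * w f)"
    using w(1) m unfolding fractional_2_realiser_def by (intro sum_mono mult_right_mono) auto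
  also have "\<dots> = m * fdim2 P"
    using w(2) by (simp add: total_weight_def flip: sum_distrib_left)
  finally show ?thesis .
qed

lemma fdim2_set_family_upper:
  fixes P :: "'a set set" and p :: real
  assumes "finite N" "P \<subseteq> Pow N" "0 < p" "p < 1"
    and card: "\<And>A. A \<in> P \<Longrightarrow> card A \<le> k"
  shows "fdim2 P \<le> 1 / (p * (1 - p) ^ k)"
proof -
  define M where "M = p * (1 - p) ^ k"
  have M: "M > 0" using assms(3,4) by (simp add: M_def)
  define v where "v S = p ^ card S * (1 - p) ^ card (N - S)" for S :: "'a set"
  have v: "v S \<ge> 0" for S using assms(3,4) by (simp add: v_def)
  define F where "F S = restrict (\<lambda>A. A \<inter> S \<noteq> {}) P" for S :: "'a set"
  have finP: "finite P" using assms(1,2) by (auto intro: finite_subset)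
  have "fdim2 P \<le> (\<Sum>S\<in>Pow N. v S / M)"
  proof (rule fdim2_le_weighted_family[OF finP])
    show "finite (Pow N)" using assms(1) by simp
    show "F S \<in> monotone_to_two P" for S
      by (auto simp: F_def monotone_to_two_def mono_on_def)
    show "0 \<le> v S / M" for S using v M by simp
  next
    fix x y assume xy: "x \<in> P" "y \<in> P" "\<not> x \<ge> y"
    then obtain i where i: "i \<in> y" "i \<notin> x" by auto
    \<comment> \<open>Sets smaller than \<open>k\<close> are missed by \<open>S\<close> with larger
      probability, so one scaling by \<open>1 / M\<close> serves both levels.\<close>
    have "M \<le> p * (1 - p) ^ card x"
      unfolding M_def using assms(3,4) card[OF xy(1)]
      by (intro mult_left_mono power_decreasing) auto
    also have "\<dots> = (\<Sum>S | S \<in> Pow N \<and> x \<inter> S = {} \<and> i \<in> S. v S)"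
      unfolding v_def using assms(1,2) xy i
      by (intro sum_Pow_disjoint_mem_weight[symmetric]) auto
    also have "\<dots> \<le> (\<Sum>S | S \<in> Pow N \<and> F S x < F S y. v S)"
      using assms(1) xy i v by (intro sum_mono2) (auto simp: F_def)
    finally show "1 \<le> (\<Sum>S | S \<in> Pow N \<and> F S x < F S y. v S / M)"
      using M by (simp add: sum_divide_distrib[symmetric])
  qed
  also have "\<dots> = 1 / M"
    using sum_Pow_weight[OF assms(1), of p] by (simp add: v_def sum_divide_distrib[symmetric])
  finally show ?thesis by (simp add: M_def)
qed

text \<open>If \<open>f A\<close> is false, monotonicity makes \<open>f\<close> false on every
  singleton inside \<open>A\<close>. Hence a separated pair has its singleton from \<open>S\<close>
  and its \<open>k\<close>-set disjoint from \<open>S\<close>.\<close>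

lemma card_separated_pairs_le:
  assumes f: "f \<in> monotone_to_two (Q_levels n 1 k)" and "k \<ge> 1" "n \<ge> 1"
  shows "real (card {(x, y) \<in> (\<lambda>(A, i). (A, {i})) `
      (SIGMA A:{A. A \<subseteq> {1..n} \<and> card A = k}. {1..n} - A). f x < f y})
    \<le> real n ^ (k + 1) * (1 / (real k + 1) * (1 - 1 / (real k + 1)) ^ k) / fact k"
    (is "real (card ?X) \<le> _")
proof -
  define S where "S = {i \<in> {1..n}. f {i}}"
  define s where "s = card S"
  have fS: "finite S" and SN: "S \<subseteq> {1..n}" by (auto simp: S_def)
  have sn: "s \<le> n" using card_mono[OF _ SN] by (simp add: s_def)
  define K where "K = {A. A \<subseteq> {1..n} - S \<and> card A = k}"
  have fK: "finite K" by (simp add: K_def)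
  have cK: "card K = (n - s) choose k"
    using n_subsets[of "{1..n} - S" k] fS SN
    by (simp add: K_def s_def card_Diff_subset)
  have "?X \<subseteq> (\<lambda>(A, i). (A, {i})) ` (K \<times> S)"
  proof clarsimp
    fix A i assume A: "A \<subseteq> {Suc 0..n}" "k = card A" "i \<notin> A" "Suc 0 \<le> i" "i \<le> n"
      and fA: "\<not> f A" and fi: "f {i}"
    have "j \<notin> S" if "j \<in> A" for j
    proof
      assume "j \<in> S"
      then have "f {j}" by (simp add: S_def)
      moreover have "{j} \<in> Q_levels n 1 k" "A \<in> Q_levels n 1 k" "{j} \<subseteq> A"
        using A that by (auto simp: Q_levels_def)
      ultimately have "f A"
        using f by (force simp: monotone_to_two_def mono_on_def)
      with fA show False ..
    qed
    then have "A \<in> K" "i \<in> S" using A fi by (auto simp: K_def S_def)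
    then show "(A, {i}) \<in> (\<lambda>(A, i). (A, {i})) ` (K \<times> S)" by force
  qed
  then have "card ?X \<le> card ((\<lambda>(A, i). (A, {i})) ` (K \<times> S))"
    using fK fS by (intro card_mono) auto
  also have "\<dots> \<le> card (K \<times> S)" using fK fS by (intro card_image_le) auto
  also have "\<dots> = ((n - s) choose k) * s" by (simp add: card_cartesian_product cK s_def)
  finally have X: "card ?X \<le> ((n - s) choose k) * s" .
  have "((n - s) choose k) * fact k \<le> (n - s) ^ k" by (rule binomial_fact_pow)
  then have "real (((n - s) choose k) * fact k) \<le> real ((n - s) ^ k)" by (rule of_nat_mono)
  then have b: "real ((n - s) choose k) * fact k \<le> (real n - real s) ^ k"
    using sn by (simp add: of_nat_diff)
  \<comment> \<open>With \<open>t\<close> the density of \<open>S\<close>, the bound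
    \<open>s * (n - s) ^ k\<close> is \<open>n ^ (k + 1)\<close> times the function maximised at the
    start.\<close>
  define t where "t = real s / real n"
  have t: "real s = real n * t" "t \<le> 1" using assms(3) sn by (auto simp: t_def)
  have "real (card ?X) * fact k \<le> real (((n - s) choose k) * s) * fact k"
    using X by (intro mult_right_mono of_nat_mono) auto
  also have "\<dots> = real s * (real ((n - s) choose k) * fact k)" by simp
  also have "\<dots> \<le> real s * (real n - real s) ^ k"
    using b by (intro mult_left_mono) auto
  also have "real n - real s = real n * (1 - t)" using t(1) by (simp add: algebra_simps)
  also have "real s * (real n * (1 - t)) ^ k = real n ^ (k + 1) * (t * (1 - t) ^ k)"
    by (simp add: t(1) power_mult_distrib)
  also have "\<dots> \<le> real n ^ (k + 1) * (1 / (real k + 1) * (1 - 1 / (real k + 1)) ^ k)"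
    using t(2) assms(2) by (intro mult_left_mono mult_power_one_minus_le_max) auto
  finally show ?thesis by (subst pos_le_divide_eq) (rule fact_gt_zero)
qed

text \<open>The product is the number of pairs, \<open>(n choose k) * (n - k)\<close>, divided by
  \<open>n ^ (k + 1) / fact k\<close>. Its factor at \<open>i = k\<close> comes from the choice of
  the singleton.\<close>

lemma fdim2_Q_levels_lower:
  assumes "k \<ge> 1" "n \<ge> k"
  shows "(\<Prod>i\<le>k. 1 - real i / real n)
    \<le> 1 / (real k + 1) * (1 - 1 / (real k + 1)) ^ k * fdim2 (Q_levels n 1 k)"
proof -
  have n: "n \<ge> 1" using assms by simp
  let ?M = "1 / (real k + 1) * (1 - 1 / (real k + 1)) ^ k"
  let ?D = "SIGMA A:{A. A \<subseteq> {1..n} \<and> card A = k}. {1..n} - A"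
  let ?R = "(\<lambda>(A, i). (A, {i})) ` ?D"
  have finR: "finite ?R" by simp
  have "card ?R = card ?D" by (intro card_image) (auto simp: inj_on_def)
  also have "\<dots> = (\<Sum>A | A \<subseteq> {1..n} \<and> card A = k. card ({1..n} - A))"
    by (simp add: card_SigmaI)
  also have "\<dots> = (\<Sum>A | A \<subseteq> {1..n} \<and> card A = k. n - k)"
    by (intro sum.cong refl) (auto simp: card_Diff_subset finite_subset)
  also have "\<dots> = (n choose k) * (n - k)"
    using n_subsets[of "{1..n}" k] by simp
  finally have cR: "real (card ?R) = real (n choose k) * (real n - real k)"
    using assms(2) by (simp add: of_nat_diff)
  have "real (card ?R) \<le> real n ^ (k + 1) * ?M / fact k * fdim2 (Q_levels n 1 k)"
  proof (rule card_pairs_le_fdim2[OF finite_Q_levels finR])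
    show "x \<in> Q_levels n 1 k \<and> y \<in> Q_levels n 1 k \<and> \<not> x \<ge> y" if "(x, y) \<in> ?R" for x y
      using that by (auto simp: Q_levels_def)
  qed (rule card_separated_pairs_le[OF _ assms(1) n])
  then have "fact k * real (n choose k) * (real n - real k)
      \<le> real n ^ (k + 1) * (?M * fdim2 (Q_levels n 1 k))"
    unfolding cR times_divide_eq_left[of _ "fact k"]
    by (subst (asm) pos_le_divide_eq) (simp_all only: fact_gt_zero mult_ac)
  moreover have "fact k * real (n choose k) = (\<Prod>i<k. real n - real i)"
    using gbinomial_mult_fact[of k "real n"]
    by (simp add: binomial_gbinomial atLeast0LessThan)
  moreover have "(\<Prod>i<k. real n - real i) * (real n - real k) = (\<Prod>i\<le>k. real n - real i)"
    by (simp add: lessThan_Suc_atMost[symmetric])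
  moreover have "(\<Prod>i\<le>k. real n - real i) = (\<Prod>i\<le>k. real n * (1 - real i / real n))"
    using n by (intro prod.cong) (auto simp: field_simps)
  moreover have "\<dots> = real n ^ (k + 1) * (\<Prod>i\<le>k. 1 - real i / real n)"
    by (simp add: prod.distrib)
  ultimately have "real n ^ (k + 1) * (\<Prod>i\<le>k. 1 - real i / real n)
      \<le> real n ^ (k + 1) * (?M * fdim2 (Q_levels n 1 k))" by simp
  then show ?thesis using n by (subst (asm) mult_le_cancel_left_pos) auto
qed

theorem theorem12:
  fixes k :: nat
  assumes "k \<ge> 1"
  shows "(\<lambda>n. fdim2 (Q_levels n 1 k)) \<longlonglongrightarrow> (1 - 1 / (real k + 1)) powi (- int k) * (real k + 1)
    \<and> (1 - 1 / (real k + 1)) powi (- int k) * (real k + 1) \<le> exp 1 * (real k + 1)"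
proof
  define p where "p = 1 / (real k + 1)"
  define M where "M = p * (1 - p) ^ k"
  have p: "0 < p" "p < 1" using assms by (auto simp: p_def)
  then have M: "M > 0" by (simp add: M_def)
  have lim: "(1 - 1 / (real k + 1)) powi (- int k) * (real k + 1) = 1 / M"
    by (simp add: M_def p_def power_int_minus field_simps)
  have lower: "\<forall>\<^sub>F n in sequentially. (\<Prod>i\<le>k. 1 - real i / real n) / M \<le> fdim2 (Q_levels n 1 k)"
    using eventually_ge_at_top[of k]
  proof eventually_elim
    case (elim n)
    then show ?case
      using fdim2_Q_levels_lower[OF assms elim, folded p_def, folded M_def] M
      by (simp add: pos_divide_le_eq mult.commute)
  qed
  have upper: "\<forall>\<^sub>F n in sequentially. fdim2 (Q_levels n 1 k) \<le> 1 / M"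
  proof (intro always_eventually allI)
    fix n
    show "fdim2 (Q_levels n 1 k) \<le> 1 / M"
      unfolding M_def using assms p
      by (intro fdim2_set_family_upper[of "{1..n}"]) (auto simp: Q_levels_def)
  qed
  \<comment> \<open>The number of factors is fixed as \<open>n\<close> grows, and each tends to
    1.\<close>
  have "(\<lambda>n. (\<Prod>i\<le>k. 1 - real i / real n) / M) \<longlonglongrightarrow> (\<Prod>i\<le>k. 1 - 0) / M"
    using M by (intro tendsto_intros lim_const_over_n) auto
  then have "(\<lambda>n. (\<Prod>i\<le>k. 1 - real i / real n) / M) \<longlonglongrightarrow> 1 / M" by simp
  from tendsto_sandwich[OF lower upper this tendsto_const]
  show "(\<lambda>n. fdim2 (Q_levels n 1 k)) \<longlonglongrightarrow> (1 - 1 / (real k + 1)) powi (- int k) * (real k + 1)"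
    unfolding lim .
  \<comment> \<open>The base is \<open>k / (k + 1)\<close>, whose inverse is
    \<open>1 + 1 / k\<close>.\<close>
  have "(1 - 1 / (real k + 1)) powi (- int k) = (1 + 1 / real k) ^ k"
    using assms by (simp add: power_int_minus field_simps)
  also have "\<dots> \<le> exp 1"
    using assms by (intro exp_ge_one_plus_x_over_n_power_n) auto
  finally show "(1 - 1 / (real k + 1)) powi (- int k) * (real k + 1) \<le> exp 1 * (real k + 1)"
    by (intro mult_right_mono) auto
qed

end
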